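(* Let $\sigma>0$. For every clipping threshold $c\ge 2\sigma$ there exists a stochastic function $f(\mathbf{x})=\mathbb{E}_{\xi\sim\mathcal{D}}[f_\xi(\mathbf{x})]$ on some $\mathbb{R}^d$ that has variance at most $\sigma^2$, i.e. $\mathbb{E}_\xi\big[\|\nabla f_\xi(\mathbf{x})-\nabla f(\mathbf{x})\|^2\big]\le\sigma^2$ for all $\mathbf{x}$, and is $(L_0,L_1)$-smooth with $L_0=1$, $L_1=0$, such that: fixed points of clipped SGD exist, i.e. there is at least one point $\mathbf{x}^\star$ with $\mathbb{E}_\xi[\mathrm{clip}_c(\nabla f_\xi(\mathbf{x}^\star))]=0$; and the fixed points $\mathbf{x}^\star$ satisfy $\|\nabla f(\mathbf{x}^\star)\|\ge \frac{\sigma^2}{6c}$ (for every such $\mathbf{x}^\star$).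
   Context: $\|\cdot\|$ is the Euclidean norm. Each $f_\xi$ is differentiable and $\mathbb{E}_\xi[\nabla f_\xi(\mathbf{x})]=\nabla f(\mathbf{x})$. $(L_0,L_1)$-smoothness: $f$ is differentiable and $\|\nabla f(\mathbf{x})-\nabla f(\mathbf{y})\|\le (L_0+L_1\|\nabla f(\mathbf{x})\|)\,\|\mathbf{x}-\mathbf{y}\|$ for all $\mathbf{x},\mathbf{y}$ with $\|\mathbf{x}-\mathbf{y}\|\le 1/L_1$. For $L_0=1,L_1=0$ (with $1/L_1=+\infty$) this says that $\nabla f$ is $1$-Lipschitz. Clipping operator: $\mathrm{clip}_c(\mathbf{u})=\min\big(1,\frac{c}{\|\mathbf{u}\|}\big)\mathbf{u}$ (with $\mathrm{clip}_c(0)=0$). *)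

theory Defs
  imports "HOL-Probability.Probability"
begin

text \<open>
  The dimension \<open>d\<close> is existentially quantified in the theorem, so it cannot be a type.
  Points of \<open>\<real>\<^sup>d\<close> are sequences vanishing from index \<open>d\<close> on, as in the library's
  \<^const>\<open>Euclidean_space\<close>.
\<close>

type_synonym vec = "nat \<Rightarrow> real"

abbreviation Rn :: "nat \<Rightarrow> vec set" where
  "Rn d \<equiv> topspace (Euclidean_space d)"

abbreviation enorm :: "nat \<Rightarrow> vec \<Rightarrow> real" where
  "enorm d x \<equiv> L2_set x {..<d}"

text \<open>Frechet differentiability; \<^const>\<open>has_derivative\<close> needs a normed space as a type.\<close>

definition has_gradient :: "nat \<Rightarrow> (vec \<Rightarrow> real) \<Rightarrow> vec \<Rightarrow> vec \<Rightarrow> bool" where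
  "has_gradient d f g x \<longleftrightarrow>
     g \<in> Rn d \<and>
     (\<forall>\<epsilon>>0. \<exists>\<delta>>0. \<forall>y\<in>Rn d. enorm d (y - x) < \<delta> \<longrightarrow>
        \<bar>f y - f x - (\<Sum>i<d. g i * (y i - x i))\<bar> \<le> \<epsilon> * enorm d (y - x))"

definition differentiable_Rn :: "nat \<Rightarrow> (vec \<Rightarrow> real) \<Rightarrow> bool" where
  "differentiable_Rn d f \<longleftrightarrow> (\<forall>x\<in>Rn d. \<exists>g. has_gradient d f g x)"

definition grad :: "nat \<Rightarrow> (vec \<Rightarrow> real) \<Rightarrow> vec \<Rightarrow> vec" where
  "grad d f x = (THE g. has_gradient d f g x)"

lemma has_gradient_unique:
  assumes x: "x \<in> Rn d" and g: "has_gradient d f g x" and h: "has_gradient d f h x"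
  shows "g = h"
proof
  fix j
  show "g j = h j"
  proof (cases "j < d")
    case False
    then show ?thesis using g h by (simp add: has_gradient_def topspace_Euclidean_space)
  next
    case j: True
    have "\<bar>g j - h j\<bar> \<le> e" if "e > 0" for e
    proof -
      have e: "e / 2 > 0" using that by simp
      obtain a where a: "a > 0" "\<And>y. y \<in> Rn d \<Longrightarrow> enorm d (y - x) < a \<Longrightarrow>
            \<bar>f y - f x - (\<Sum>i<d. g i * (y i - x i))\<bar> \<le> e / 2 * enorm d (y - x)"
        using g e unfolding has_gradient_def by blast
      obtain b where b: "b > 0" "\<And>y. y \<in> Rn d \<Longrightarrow> enorm d (y - x) < b \<Longrightarrow>
            \<bar>f y - f x - (\<Sum>i<d. h i * (y i - x i))\<bar> \<le> e / 2 * enorm d (y - x)"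
        using h e unfolding has_gradient_def by blast
      define t where "t = min a b / 2"
      have t: "t > 0" "t < a" "t < b" using a(1) b(1) by (auto simp: t_def min_def)
      define y where "y = x(j := x j + t)"
      have y: "y \<in> Rn d" using x j by (auto simp: y_def topspace_Euclidean_space)
      have diff: "y i - x i = (if i = j then t else 0)" for i by (simp add: y_def)
      have "(\<Sum>i<d. (if i = j then t else 0)\<^sup>2) = (\<Sum>i<d. if i = j then t\<^sup>2 else 0)"
        by (rule sum.cong) auto
      then have n: "enorm d (y - x) = t"
        using j t by (simp add: L2_set_def diff)
      have s: "(\<Sum>i<d. k i * (y i - x i)) = k j * t" for k :: vec
        using j by (simp add: diff if_distrib[of "(*) _"] cong: if_cong)
      have "\<bar>f y - f x - g j * t\<bar> \<le> e / 2 * t" "\<bar>f y - f x - h j * t\<bar> \<le> e / 2 * t"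
        using a(2)[OF y] b(2)[OF y] n s t by auto
      moreover have "\<bar>u - v\<bar> \<le> m + m" if "\<bar>w - u\<bar> \<le> m" "\<bar>w - v\<bar> \<le> m" for u v w m :: real
        using that by linarith
      ultimately have "\<bar>g j * t - h j * t\<bar> \<le> e / 2 * t + e / 2 * t" by blast
      then have "\<bar>g j * t - h j * t\<bar> \<le> e * t" by simp
      moreover have "\<bar>g j * t - h j * t\<bar> = \<bar>g j - h j\<bar> * t"
        using t(1) by (simp add: abs_mult flip: left_diff_distrib)
      ultimately show ?thesis using t(1) by simp
    qed
    from this[of "\<bar>g j - h j\<bar> / 2"] show ?thesis
      by (cases "g j = h j") simp_all
  qed
qed

lemma grad_eqI: "x \<in> Rn d \<Longrightarrow> has_gradient d f g x \<Longrightarrow> grad d f x = g"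
  unfolding grad_def by (blast intro: has_gradient_unique)

text \<open>The case \<open>L1 = 0\<close> encodes the convention \<open>1/L1 = +\<infinity>\<close>.\<close>

definition L0L1_smooth :: "nat \<Rightarrow> real \<Rightarrow> real \<Rightarrow> (vec \<Rightarrow> real) \<Rightarrow> bool" where
  "L0L1_smooth d L0 L1 f \<longleftrightarrow>
     differentiable_Rn d f \<and>
     (\<forall>x\<in>Rn d. \<forall>y\<in>Rn d. L1 = 0 \<or> enorm d (x - y) \<le> 1 / L1 \<longrightarrow>
        enorm d (grad d f x - grad d f y) \<le> (L0 + L1 * enorm d (grad d f x)) * enorm d (x - y))"

text \<open>Since \<open>c / 0 = 0\<close>, this gives \<open>clip d c 0 = 0\<close>.\<close>

definition clip :: "nat \<Rightarrow> real \<Rightarrow> vec \<Rightarrow> vec" where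
  "clip d c u = (\<lambda>i. min 1 (c / enorm d u) * u i)"

text \<open>
  \<open>F \<xi>\<close> is the realization \<open>f\<^sub>\<xi>\<close>, with \<open>\<xi>\<close> distributed according to \<open>D\<close>; expectations of vectors
  are taken componentwise. \<^const>\<open>has_bochner_integral\<close> includes integrability.
\<close>

definition stochastic_function ::
    "nat \<Rightarrow> 'a measure \<Rightarrow> ('a \<Rightarrow> vec \<Rightarrow> real) \<Rightarrow> (vec \<Rightarrow> real) \<Rightarrow> bool" where
  "stochastic_function d D F f \<longleftrightarrow>
     prob_space D \<and>
     (\<forall>\<xi>\<in>space D. differentiable_Rn d (F \<xi>)) \<and>
     differentiable_Rn d f \<and>
     (\<forall>x\<in>Rn d. has_bochner_integral D (\<lambda>\<xi>. F \<xi> x) (f x)) \<and>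
     (\<forall>x\<in>Rn d. \<forall>i<d. has_bochner_integral D (\<lambda>\<xi>. grad d (F \<xi>) x i) (grad d f x i))"

definition variance_at_most ::
    "nat \<Rightarrow> 'a measure \<Rightarrow> ('a \<Rightarrow> vec \<Rightarrow> real) \<Rightarrow> (vec \<Rightarrow> real) \<Rightarrow> real \<Rightarrow> bool" where
  "variance_at_most d D F f v \<longleftrightarrow>
     (\<forall>x\<in>Rn d.
        integrable D (\<lambda>\<xi>. (enorm d (grad d (F \<xi>) x - grad d f x))\<^sup>2) \<and>
        (\<integral>\<xi>. (enorm d (grad d (F \<xi>) x - grad d f x))\<^sup>2 \<partial>D) \<le> v)"

definition clipped_SGD_fixed_point ::
    "nat \<Rightarrow> 'a measure \<Rightarrow> ('a \<Rightarrow> vec \<Rightarrow> real) \<Rightarrow> real \<Rightarrow> vec \<Rightarrow> bool" where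
  "clipped_SGD_fixed_point d D F c x \<longleftrightarrow>
     x \<in> Rn d \<and> (\<forall>i<d. has_bochner_integral D (\<lambda>\<xi>. clip d c (grad d (F \<xi>) x) i) 0)"

end

theory Submission
  imports Defs
begin

text \<open>
  In dimension one take \<open>f x = x\<^sup>2 / 2\<close> and \<open>f\<^sub>\<xi> x = x\<^sup>2 / 2 + \<xi> x\<close>, where \<open>\<xi>\<close> is centred and takes
  the value \<open>2 c\<close> with a small probability \<open>r / (1 + r)\<close> and \<open>- 2 r c\<close> otherwise. For
  \<open>r = \<sigma>\<^sup>2 / (4 c\<^sup>2)\<close> its variance is \<open>4 r c\<^sup>2 = \<sigma>\<^sup>2\<close>. Clipping cuts the rare large gradient from
  about \<open>2 c\<close> down to \<open>c\<close>, which shifts the balance point from \<open>0\<close> to \<open>r c = \<sigma>\<^sup>2 / (4 c)\<close>.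
\<close>

lemma enorm_one: "enorm 1 x = \<bar>x 0\<bar>"
  by (simp add: L2_set_def lessThan_Suc)

text \<open>Since \<open>enorm 1\<close> is the absolute value of coordinate 0, the epsilon-delta
  condition is that of an ordinary derivative. The zeros beyond index 0 place the gradient in
  \<open>Rn 1\<close>.\<close>

lemma has_gradient_one:
  assumes "(h has_real_derivative h') (at (x 0))"
  shows "has_gradient 1 (\<lambda>y. h (y 0)) (\<lambda>i. if i = 0 then h' else 0) x"
  unfolding has_gradient_def
proof (intro conjI allI impI)
  show "(\<lambda>i. if i = 0 then h' else 0) \<in> Rn 1"
    by (simp add: topspace_Euclidean_space)
next
  fix e :: real
  assume "e > 0"
  with assms obtain \<delta> where "\<delta> > 0"
    and \<delta>: "\<And>t. \<bar>t - x 0\<bar> < \<delta> \<Longrightarrow> \<bar>h t - h (x 0) - h' * (t - x 0)\<bar> \<le> e * \<bar>t - x 0\<bar>"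
    unfolding has_field_derivative_def has_derivative_within_alt
    by (metis UNIV_I real_norm_def)
  then show "\<exists>\<delta>>0. \<forall>y\<in>Rn 1. enorm 1 (y - x) < \<delta> \<longrightarrow>
      \<bar>h (y 0) - h (x 0) - (\<Sum>i<1. (if i = 0 then h' else 0) * (y i - x i))\<bar>
        \<le> e * enorm 1 (y - x)"
    unfolding enorm_one by (auto simp: lessThan_Suc)
qed

lemma has_gradient_quadratic:
  "has_gradient 1 (\<lambda>y. (y 0)\<^sup>2 / 2 + a * y 0) (\<lambda>i. if i = 0 then x 0 + a else 0) x"
  by (rule has_gradient_one) (auto intro!: derivative_eq_intros)

lemma grad_quadratic:
  assumes "x \<in> Rn 1"
  shows "grad 1 (\<lambda>y. (y 0)\<^sup>2 / 2 + a * y 0) x = (\<lambda>i. if i = 0 then x 0 + a else 0)"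
  using grad_eqI[OF assms has_gradient_quadratic] .

lemma differentiable_quadratic:
  "differentiable_Rn 1 (\<lambda>y. (y 0)\<^sup>2 / 2 + a * y 0)"
  unfolding differentiable_Rn_def using has_gradient_quadratic by blast

definition two_point_pmf :: "real \<Rightarrow> 'a \<Rightarrow> 'a \<Rightarrow> 'a pmf" where
  "two_point_pmf p a b = map_pmf (\<lambda>t. if t then a else b) (bernoulli_pmf p)"

lemma has_bochner_integral_two_point_pmf:
  fixes g :: "'a \<Rightarrow> real"
  assumes "0 \<le> p" "p \<le> 1"
  shows "has_bochner_integral (measure_pmf (two_point_pmf p a b)) g (p * g a + (1 - p) * g b)"
  unfolding has_bochner_integral_iff
proof
  show "integrable (measure_pmf (two_point_pmf p a b)) g"
    by (rule integrable_measure_pmf_finite) (simp add: two_point_pmf_def)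
  show "(\<integral>x. g x \<partial>measure_pmf (two_point_pmf p a b)) = p * g a + (1 - p) * g b"
    using assms by (simp add: two_point_pmf_def)
qed

lemma clip_one:
  assumes "c > 0"
  shows "clip 1 c u 0 = (if \<bar>u 0\<bar> \<le> c then u 0 else c * sgn (u 0))"
  using assms unfolding clip_def enorm_one
  by (auto simp: min_def field_simps sgn_real_def abs_if)

text \<open>Up to the factor \<open>1 / (1 + r)\<close>, the left side is the mean clipped gradient
  at \<open>x\<close>. If \<open>x \<ge> - c\<close>, the rare gradient is clipped to
  \<open>c\<close>, so the frequent one must be clipped to \<open>- (r * c)\<close>. If
  \<open>x < - c\<close>, the frequent one gives \<open>- c\<close> and the rare one at most
  \<open>r * c < c\<close>, so the sum is negative.\<close>

lemma clipped_balance_iff: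
  fixes r c x :: real
  defines "k \<equiv> \<lambda>u. if \<bar>u\<bar> \<le> c then u else c * sgn u"
  assumes c: "c > 0" and r: "0 < r" "r < 1"
  shows "r * k (x + 2 * c) + k (x - 2 * r * c) = 0 \<longleftrightarrow> x = r * c"
proof -
  have rc: "0 < r * c" "r * c < c"
    using c r by auto
  have lo: "k u = - c" if "u \<le> - c" for u
    using that c by (auto simp: k_def)
  have hi: "k u = c" if "u \<ge> c" for u
    using that c by (auto simp: k_def)
  show ?thesis
  proof (cases "x \<ge> - c")
    case True
    then have "k (x + 2 * c) = c" by (intro hi) simp
    moreover have "k (x - 2 * r * c) = - (r * c) \<longleftrightarrow> x - 2 * r * c = - (r * c)"
    proof (cases "\<bar>x - 2 * r * c\<bar> \<le> c")
      \<comment> \<open>A truly clipped value is \<open>c\<close> or \<open>- c\<close>, never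
        \<open>- (r * c)\<close>, so both sides of the equivalence fail.\<close>
      case False
      then have "x - 2 * r * c \<le> - c \<or> x - 2 * r * c \<ge> c" by linarith
      then show ?thesis using lo hi rc by fastforce
    qed (simp add: k_def)
    ultimately show ?thesis by (auto simp: algebra_simps)
  next
    case False
    then have "k (x - 2 * r * c) = - c" using rc by (intro lo) simp
    moreover have "k (x + 2 * c) \<le> c" using c by (auto simp: k_def sgn_real_def)
    then have "r * k (x + 2 * c) \<le> r * c" using r by simp
    ultimately show ?thesis using rc False by auto
  qed
qed

theorem theorem3p2:
  fixes \<sigma> c :: real
  assumes "\<sigma> > 0" and "c \<ge> 2 * \<sigma>"
  shows "\<exists>(d::nat) (D :: real measure) (F :: real \<Rightarrow> vec \<Rightarrow> real) (f :: vec \<Rightarrow> real).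
           d \<ge> 1 \<and>
           stochastic_function d D F f \<and>
           variance_at_most d D F f (\<sigma>\<^sup>2) \<and>
           L0L1_smooth d 1 0 f \<and>
           (\<exists>x. clipped_SGD_fixed_point d D F c x) \<and>
           (\<forall>x. clipped_SGD_fixed_point d D F c x \<longrightarrow>
              enorm d (grad d f x) \<ge> \<sigma>\<^sup>2 / (6 * c))"
proof -
  define r where "r = \<sigma>\<^sup>2 / (4 * c\<^sup>2)"
  \<comment> \<open>Thus \<open>r\<close> is the odds \<open>p / (1 - p)\<close>, and the two values
    balance: \<open>p * (2 * c) = (1 - p) * (2 * r * c)\<close>.\<close>
  define p where "p = r / (1 + r)"
  define D where "D = measure_pmf (two_point_pmf p (2 * c) (- 2 * r * c))"
  define F where "F = (\<lambda>\<xi> (y :: vec). (y 0)\<^sup>2 / 2 + \<xi> * y 0)"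
  \<comment> \<open>As the noise is centred, the mean is the realization at \<xi> = 0, so facts
    about \<open>F\<close> also serve \<open>f\<close>.\<close>
  define f where "f = F 0"
  have c: "c > 0" using assms by simp
  have r0: "r > 0" using assms(1) c by (simp add: r_def)
  have "\<sigma>\<^sup>2 < (2 * c)\<^sup>2" using assms by (intro power_strict_mono) auto
  then have r1: "r < 1" using c by (simp add: r_def power_mult_distrib)
  have var: "4 * r * c\<^sup>2 = \<sigma>\<^sup>2" and rc: "r * c = \<sigma>\<^sup>2 / (4 * c)"
    using c by (simp_all add: r_def field_simps power2_eq_square)
  have p: "0 \<le> p" "p \<le> 1" using r0 by (simp_all add: p_def)
  have p': "1 - p = 1 / (1 + r)" using r0 by (simp add: p_def field_simps)
  have int: "has_bochner_integral D g ((r * g (2 * c) + g (- 2 * r * c)) / (1 + r))"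
    for g :: "real \<Rightarrow> real"
    using has_bochner_integral_two_point_pmf[OF p, of "2 * c" "- 2 * r * c" g]
    by (simp add: D_def p' add_divide_distrib) (simp add: p_def)
  \<comment> \<open>Uniqueness of the integral turns each claim about an expectation into an
    equation between reals.\<close>
  have int_eq: "has_bochner_integral D g v \<longleftrightarrow>
      (r * g (2 * c) + g (- 2 * r * c)) / (1 + r) = v" for g v
    using int[of g] has_bochner_integral_eq by blast
  have diff: "differentiable_Rn 1 (F \<xi>)" for \<xi>
    unfolding F_def by (rule differentiable_quadratic)
  have grad: "grad 1 (F \<xi>) x = (\<lambda>i. if i = 0 then x 0 + \<xi> else 0)" if "x \<in> Rn 1" for \<xi> x
    unfolding F_def using that by (rule grad_quadratic)
  have "stochastic_function 1 D F f"
    unfolding stochastic_function_def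
  proof (intro conjI ballI allI impI)
    show "prob_space D" unfolding D_def by (rule prob_space_measure_pmf)
    show "has_bochner_integral D (\<lambda>\<xi>. F \<xi> x) (f x)" for x
      unfolding int_eq using r0 by (simp add: F_def f_def field_simps)
    show "has_bochner_integral D (\<lambda>\<xi>. grad 1 (F \<xi>) x i) (grad 1 f x i)"
      if "x \<in> Rn 1" "i < 1" for x i
      unfolding int_eq f_def using r0 that by (simp add: grad field_simps del: One_nat_def)
  qed (simp_all add: f_def diff del: One_nat_def)
  moreover have "variance_at_most 1 D F f (\<sigma>\<^sup>2)"
    unfolding variance_at_most_def
  proof (intro ballI)
    fix x assume x: "x \<in> Rn 1"
    \<comment> \<open>The gradient noise is \<xi> at every point, so the second moment of \<xi>
      suffices: \<open>r * (2 * c)\<^sup>2 + (2 * r * c)\<^sup>2 = (1 + r) * (4 * r *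
      c\<^sup>2)\<close>.\<close>
    have "has_bochner_integral D (\<lambda>\<xi>. \<xi>\<^sup>2) (\<sigma>\<^sup>2)"
      unfolding int_eq var[symmetric] using r0 by (simp add: field_simps power2_eq_square)
    then show "integrable D (\<lambda>\<xi>. (enorm 1 (grad 1 (F \<xi>) x - grad 1 f x))\<^sup>2) \<and>
        (\<integral>\<xi>. (enorm 1 (grad 1 (F \<xi>) x - grad 1 f x))\<^sup>2 \<partial>D) \<le> \<sigma>\<^sup>2"
      unfolding enorm_one using x by (simp add: f_def grad has_bochner_integral_iff del: One_nat_def)
  qed
  \<comment> \<open>The gradient of \<open>f\<close> at \<open>x\<close> has coordinate
    \<open>x 0\<close>, so the bound holds with equality.\<close>
  moreover have "L0L1_smooth 1 1 0 f"
    unfolding L0L1_smooth_def enorm_one using diff by (simp add: f_def grad del: One_nat_def)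
  moreover have fixed_iff: "clipped_SGD_fixed_point 1 D F c x \<longleftrightarrow> x \<in> Rn 1 \<and> x 0 = r * c" for x
  proof (cases "x \<in> Rn 1")
    case True
    then have "clipped_SGD_fixed_point 1 D F c x \<longleftrightarrow>
        r * clip 1 c (grad 1 (F (2 * c)) x) 0 + clip 1 c (grad 1 (F (- 2 * r * c)) x) 0 = 0"
      unfolding clipped_SGD_fixed_point_def int_eq using r0 by simp
    also have "\<dots> \<longleftrightarrow> x 0 = r * c"
    proof -
      have grad_0: "grad 1 (F \<xi>) x 0 = x 0 + \<xi>" for \<xi>
        using grad[OF True] by simp
      show ?thesis
        using clipped_balance_iff[OF c r0 r1, of "x 0"]
        unfolding clip_one[OF c] grad_0 by (simp cong: if_cong split del: if_split)
    qed
    finally show ?thesis using True by simp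
  qed (simp add: clipped_SGD_fixed_point_def)
  moreover have "\<exists>x. clipped_SGD_fixed_point 1 D F c x"
    unfolding fixed_iff
    by (rule exI[of _ "\<lambda>i. if i = 0 then r * c else 0"]) (simp add: topspace_Euclidean_space)
  moreover have "enorm 1 (grad 1 f x) \<ge> \<sigma>\<^sup>2 / (6 * c)" if "clipped_SGD_fixed_point 1 D F c x" for x
  proof -
    have "enorm 1 (grad 1 f x) = \<sigma>\<^sup>2 / (4 * c)"
      using that c unfolding fixed_iff enorm_one by (simp add: f_def grad rc del: One_nat_def)
    \<comment> \<open>The construction attains the factor 1/4, which exceeds the required
      1/6.\<close>
    also have "\<dots> \<ge> \<sigma>\<^sup>2 / (6 * c)"
      using c by (intro divide_left_mono) auto
    finally show ?thesis .
  qed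
  ultimately show ?thesis by blast
qed

end
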